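(* Let $\phi(x) := (2\pi)^{-1/2} \exp(-x^2/2)$, and let $f_{\mu,\sigma}(x) := \phi((x-\mu)/\sigma)/\sigma$ for $\mu \in \mathbb{R}$ and $\sigma \ge 1/6$. Let $Y$ be a random variable with density $f_{\mu,\sigma}$, let $g_{\mu,\sigma}(x) := \sum_{z \in \mathbb{Z}} f_{\mu,\sigma}(z+x)$ for $x \in \mathbb{R}$, and let $G_{\mu,\sigma}(x) := \mathbb{P}(Y - \lfloor Y \rfloor \le x)$ for $0 \le x \le 1$. Then $$\mathrm{R}(g_{\mu,\sigma}) \le 4.5 \cdot h\bigl(\lfloor 36\sigma^2 \rfloor\bigr),$$ $$\mathrm{KD}(G_{\mu,\sigma}) \le 0.75 \cdot h\bigl(\lfloor 36\sigma^2 \rfloor\bigr),$$ $$\mathrm{MRAE}(G_{\mu,\sigma}) \le 3 \cdot h\bigl(\lfloor 36\sigma^2 \rfloor\bigr),$$ where $h(m) := \sqrt{m!/m^m}$ for integers $m \ge 1$.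
   Context: For a periodic function $g:\mathbb{R}\to\mathbb{R}$ with period 1, $\mathrm{R}(g) := \sup_{x,y \in \mathbb{R}} |g(y) - g(x)|$. For a c.d.f. $G$ of a random variable with values in $[0,1)$, the Kuiper distance from the uniform distribution on $[0,1)$ is $\mathrm{KD}(G) := \sup_{0 \le x < y \le 1} |G(y) - G(x) - (y-x)|$, and the maximal relative approximation error is $\mathrm{MRAE}(G) := \sup_{0 \le x < y \le 1} \bigl| \frac{G(y)-G(x)}{y-x} - 1 \bigr|$. *)

theory Defs
  imports "HOL-Probability.Probability"
begin

definition gauss_dens :: "real \<Rightarrow> real \<Rightarrow> real \<Rightarrow> real" where
  "gauss_dens \<mu> \<sigma> x = std_normal_density ((x - \<mu>) / \<sigma>) / \<sigma>"

lemma gauss_dens_eq: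
  "gauss_dens \<mu> \<sigma> x = (2 * pi) powr (- 1 / 2) * exp (- (((x - \<mu>) / \<sigma>)\<^sup>2 / 2)) / \<sigma>"
  by (simp add: gauss_dens_def std_normal_density_def powr_minus_divide powr_half_sqrt)

lemma gauss_dens_eq_normal_density:
  "\<sigma> > 0 \<Longrightarrow> gauss_dens \<mu> \<sigma> x = normal_density \<mu> \<sigma> x"
  by (simp add: gauss_dens_def normal_density_def real_sqrt_mult power_divide)

definition wrapped_dens :: "real \<Rightarrow> real \<Rightarrow> real \<Rightarrow> real" where
  "wrapped_dens \<mu> \<sigma> x = (\<Sum>\<^sub>\<infinity>z\<in>(UNIV :: int set). gauss_dens \<mu> \<sigma> (of_int z + x))"

definition (in prob_space) frac_cdf :: "('a \<Rightarrow> real) \<Rightarrow> real \<Rightarrow> real" where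
  "frac_cdf Y x = \<P>(\<omega> in M. Y \<omega> - of_int \<lfloor>Y \<omega>\<rfloor> \<le> x)"

(* The suprema are taken in the extended reals, where they always exist; on type real the
   supremum of an unbounded set is unspecified. An upper bound by a real number
   thus includes boundedness. *)

definition osc :: "(real \<Rightarrow> real) \<Rightarrow> ereal" where
  "osc g = (SUP (x, y) \<in> UNIV. ereal \<bar>g y - g x\<bar>)"

definition kuiper_dist :: "(real \<Rightarrow> real) \<Rightarrow> ereal" where
  "kuiper_dist G = (SUP (x, y) \<in> {(x, y). 0 \<le> x \<and> x < y \<and> y \<le> 1}.
     ereal \<bar>G y - G x - (y - x)\<bar>)"

definition mrae :: "(real \<Rightarrow> real) \<Rightarrow> ereal" where
  "mrae G = (SUP (x, y) \<in> {(x, y). 0 \<le> x \<and> x < y \<and> y \<le> 1}.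
     ereal \<bar>(G y - G x) / (y - x) - 1\<bar>)"

definition hfun :: "nat \<Rightarrow> real" where
  "hfun m = sqrt (fact m / real m ^ m)"

end

theory Submission
  imports Defs
begin

text \<open>Poisson summation gives the cosine series
  \<open>g(x) = 1 + 2 \<Sum>\<^sub>n q\<^bsup>n\<^sup>2\<^esup> cos (2 \<pi> n (x - \<mu>))\<close>, summed over \<open>n \<ge> 1\<close>, with
  \<open>q = exp (- 2 \<pi>\<^sup>2 \<sigma>\<^sup>2)\<close>: the Fourier coefficients of the wrapped density are values of the
  Gaussian characteristic function. Since \<open>2 \<pi>\<^sup>2 > 19.7\<close> and \<open>m! \<ge> e (m / e)\<^bsup>m\<^esup>\<close>, the series
  stays within \<open>1.5 h\<close> of 1. The bounds on the range and on the MRAE are immediate; for the Kuiper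
  distance, the integral of \<open>g - 1\<close> over \<open>[x, y]\<close> is minus that over the complement in \<open>[0, 1]\<close>,
  and one of the two sets has length at most \<open>1 / 2\<close>.\<close>

section \<open>Termwise integration of dominated series\<close>

text \<open>The M-test gives uniform convergence along the filter of finite subsets, and integrals
  over a compact interval commute with uniform limits. The index set is general because the lemma
  serves both the sum over the integers defining \<open>wrapped_dens\<close> and the cosine series
  over the naturals.\<close>

lemma has_sum_integral_infsum:
  fixes f :: "'i \<Rightarrow> real \<Rightarrow> real"
  assumes cont: "\<And>i. continuous_on {a..b} (f i)"
    and bound: "\<And>i x. x \<in> {a..b} \<Longrightarrow> \<bar>f i x\<bar> \<le> B i"
    and summable: "B summable_on I"
  shows "continuous_on {a..b} (\<lambda>x. \<Sum>\<^sub>\<infinity>i\<in>I. f i x)"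
    and "((\<lambda>i. integral {a..b} (f i)) has_sum integral {a..b} (\<lambda>x. \<Sum>\<^sub>\<infinity>i\<in>I. f i x)) I"
proof -
  have ul: "uniform_limit {a..b} (\<lambda>X x. \<Sum>i\<in>X. f i x) (\<lambda>x. \<Sum>\<^sub>\<infinity>i\<in>I. f i x) (finite_subsets_at_top I)"
    using bound summable by (intro Weierstrass_m_test_general[where M = B]) auto
  have c: "continuous_on {a..b} (\<lambda>x. \<Sum>i\<in>X. f i x)" for X
    by (intro continuous_on_sum cont)
  show "continuous_on {a..b} (\<lambda>x. \<Sum>\<^sub>\<infinity>i\<in>I. f i x)"
    by (rule uniform_limit_theorem[OF _ ul]) (auto intro: c)
  obtain J K where J: "\<And>X. ((\<lambda>x. \<Sum>i\<in>X. f i x) has_integral J X) {a..b}"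
    and K: "((\<lambda>x. \<Sum>\<^sub>\<infinity>i\<in>I. f i x) has_integral K) {a..b}"
    and lim: "(J \<longlongrightarrow> K) (finite_subsets_at_top I)"
    using uniform_limit_integral[OF ul c] by auto
  have "J X = (\<Sum>i\<in>X. integral {a..b} (f i))" if "finite X" for X
    using J[of X] integral_sum[OF that, of f "{a..b}"] cont
    by (metis integrable_continuous_real integral_unique)
  then have "eventually (\<lambda>X. J X = (\<Sum>i\<in>X. integral {a..b} (f i))) (finite_subsets_at_top I)"
    by (auto intro: eventually_finite_subsets_at_top_weakI)
  with lim show "((\<lambda>i. integral {a..b} (f i)) has_sum integral {a..b} (\<lambda>x. \<Sum>\<^sub>\<infinity>i\<in>I. f i x)) I"
    unfolding has_sum_def integral_unique[OF K] by (rule Lim_transform_eventually)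
qed

section \<open>Orthogonality of cosines and uniqueness of cosine coefficients\<close>

lemma cos_add_2pi_int: "cos (t + 2 * pi * of_int k) = cos t"
  using cos.plus_of_int[of t k] by (simp add: mult.commute)

lemma has_integral_cos_2pi:
  "((\<lambda>x. cos (2 * pi * of_int m * x)) has_integral (if m = 0 then 1 else 0)) {0..1}"
proof (cases "m = 0")
  case True
  then show ?thesis
    using has_integral_const_real[of "1::real" 0 1] by simp
next
  case False
  have "((\<lambda>x. cos (2 * pi * of_int m * x)) has_integral
      (sin (2 * pi * of_int m * 1) / (2 * pi * of_int m) - sin (2 * pi * of_int m * 0) / (2 * pi * of_int m))) {0..1}"
    using False
    by (intro fundamental_theorem_of_calculus)
       (auto intro!: derivative_eq_intros simp flip: has_real_derivative_iff_has_vector_derivative)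
  moreover have "sin (2 * pi * of_int m) = 0"
    by (simp add: sin_zero_iff_int2)
  ultimately show ?thesis
    using False by simp
qed

text \<open>The product-to-sum formula reduces this to \<open>has_integral_cos_2pi\<close>, whose
  frequency is an integer because \<open>m - n\<close> may be negative. The case
  \<open>m = n = 0\<close>, where the integral is 1, is excluded.\<close>

lemma integral_cos_2pi_times_cos_2pi:
  fixes m n :: nat
  assumes "m > 0"
  shows "integral {0..1} (\<lambda>x. cos (2 * pi * m * x) * cos (2 * pi * n * x)) = (if m = n then 1 / 2 else 0)"
proof -
  have eq: "cos (2 * pi * m * x) * cos (2 * pi * n * x) =
      (cos (2 * pi * of_int (int m - int n) * x) + cos (2 * pi * of_int (int m + int n) * x)) / 2" for x
    by (simp add: cos_times_cos algebra_simps)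
  have "((\<lambda>x. cos (2 * pi * m * x) * cos (2 * pi * n * x)) has_integral
      ((if int m - int n = 0 then 1 else 0) + (if int m + int n = 0 then 1 else 0)) / 2) {0..1}"
    unfolding eq by (intro has_integral_divide has_integral_add has_integral_cos_2pi)
  then show ?thesis
    using assms by (auto dest!: integral_unique split: if_splits)
qed

text \<open>An even 1-periodic function is a function of \<open>cos (2 \<pi> x)\<close>, so the one-dimensional
  Weierstrass theorem makes its cosine coefficients determine it.\<close>

lemma cosine_coefficients_zero_imp_zero:
  fixes D :: "real \<Rightarrow> real"
  assumes cont: "continuous_on {0..1} D"
    and refl: "\<And>x. D (1 - x) = D x"
    and coeff: "\<And>n::nat. integral {0..1} (\<lambda>x. D x * cos (2 * pi * n * x)) = 0"
    and x: "x \<in> {0..1}"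
  shows "D x = 0"
proof -
  define c where "c t = cos (2 * pi * t)" for t :: real
  have cc: "continuous_on S c" for S
    unfolding c_def by (intro continuous_intros)
  have cp: "continuous_on {0..1} (\<lambda>x. D x * c x ^ k * cos (2 * pi * real n * x))" for k n
    by (intro continuous_intros cont cc)
  have cpc: "continuous_on {0..1} (\<lambda>x. D x * p (c x))" if "continuous_on UNIV p" for p
    by (intro continuous_intros cont continuous_on_compose2[OF that] cc) auto
  \<comment> \<open>The induction on \<open>k\<close> needs all \<open>n\<close> at once:
    multiplying the cosine of frequency \<open>n\<close> by \<open>c x\<close> yields the mean of
    those of frequencies \<open>n - 1\<close> and \<open>n + 1\<close>. For \<open>n = 0\<close> the
    product is the cosine of frequency 1.\<close>
  have mono: "integral {0..1} (\<lambda>x. D x * c x ^ k * cos (2 * pi * real n * x)) = 0" for k n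
  proof (induction k arbitrary: n)
    case 0
    then show ?case using coeff by simp
  next
    case (Suc k)
    show ?case
    proof (cases n)
      case 0
      have "D x * c x ^ Suc k * cos (2 * pi * real n * x) = D x * c x ^ k * cos (2 * pi * real 1 * x)" for x
        using 0 by (simp add: c_def)
      then show ?thesis using Suc.IH[of 1] by (simp only:)
    next
      case (Suc m)
      have "c x * cos (2 * pi * real n * x) =
          (cos (2 * pi * real m * x) + cos (2 * pi * real (Suc n) * x)) / 2" for x
        unfolding c_def mult.commute[of "cos (2 * pi * x)"] cos_times_cos
        by (simp add: Suc algebra_simps)
      then have "D x * c x ^ k * (c x * cos (2 * pi * real n * x)) = D x * c x ^ k *
          ((cos (2 * pi * real m * x) + cos (2 * pi * real (Suc n) * x)) / 2)" for x
        by (simp only:)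
      then have "D x * c x ^ Suc k * cos (2 * pi * real n * x) =
          (D x * c x ^ k * cos (2 * pi * real m * x) + D x * c x ^ k * cos (2 * pi * real (Suc n) * x)) / 2" for x
        by (simp only: power_Suc2 mult.assoc distrib_left add_divide_distrib times_divide_eq_right)
      moreover have "integral {0..1} (\<lambda>x. (D x * c x ^ k * cos (2 * pi * real m * x) +
          D x * c x ^ k * cos (2 * pi * real (Suc n) * x)) / 2) = 0"
        unfolding integral_divide
        by (subst integral_add) (auto intro!: integrable_continuous_real cp simp: Suc.IH simp del: of_nat_Suc)
      ultimately show ?thesis by (simp only:)
    qed
  qed
  have poly0: "integral {0..1} (\<lambda>x. D x * p (c x)) = 0" if "real_polynomial_function p" for p
  proof -
    from that obtain a n where p: "p = (\<lambda>x. \<Sum>i\<le>n. a i * x ^ i)"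
      unfolding real_polynomial_function_iff_sum by blast
    have "D x * p (c x) = (\<Sum>i\<le>n. a i * (D x * c x ^ i * cos (2 * pi * real 0 * x)))" for x
      by (simp add: p sum_distrib_left algebra_simps)
    then show ?thesis
      by (simp only:, subst integral_sum)
         (auto intro!: integrable_continuous_real continuous_intros cont cc simp only: mono integral_mult_right finite_atMost mult_zero_right sum.neutral_const)
  qed
  \<comment> \<open>\<open>E\<close> is the function with \<open>D = E o c\<close>:
    \<open>arccos\<close> inverts \<open>c\<close> up to scaling on [0, 1/2], and the reflection
    symmetry of \<open>D\<close> covers [1/2, 1].\<close>
  define E where "E u = D (arccos u / (2 * pi))" for u
  have contE: "continuous_on {-1..1} E"
    unfolding E_def
    by (rule continuous_on_compose2[OF cont])
       (auto intro!: continuous_intros arccos_lbound divide_nonneg_pos simp: field_simps,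
        use arccos_ubound pi_gt_zero in \<open>smt (verit)\<close>)
  have DE: "D t = E (c t)" if "t \<in> {0..1}" for t
  proof (cases "t \<le> 1 / 2")
    case True
    then have "arccos (c t) = 2 * pi * t"
      using that unfolding c_def by (intro arccos_cos) auto
    then show ?thesis by (simp add: E_def)
  next
    case False
    have "c t = cos (2 * pi * (1 - t))"
      unfolding c_def by (simp add: right_diff_distrib cos_diff)
    then have "arccos (c t) = 2 * pi * (1 - t)"
      using that False by (simp add: arccos_cos)
    then show ?thesis by (simp add: E_def refl)
  qed
  have contDD: "continuous_on {0..1} (\<lambda>x. D x * D x)"
    by (intro continuous_intros cont)
  define A where "A = integral {0..1} (\<lambda>x. \<bar>D x\<bar>)"
  \<comment> \<open>\<open>D\<close> is orthogonal to \<open>p o c\<close>, so the integral of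
    \<open>D * D\<close> equals that of \<open>D * (D - p o c)\<close>, whose second factor is
    smaller than \<open>e\<close>.\<close>
  have eA: "integral {0..1} (\<lambda>x. D x * D x) \<le> e * A" if e: "e > 0" for e
  proof -
    obtain p where p: "real_polynomial_function p" "\<And>u. u \<in> {-1..1} \<Longrightarrow> \<bar>E u - p u\<bar> < e"
      using Stone_Weierstrass_real_polynomial_function[OF _ contE e] by auto
    have pc: "continuous_on UNIV p"
      using p(1) by (intro continuous_on_polymonial_function) (simp add: real_polynomial_function_eq)
    have "integral {0..1} (\<lambda>x. D x * D x) =
        integral {0..1} (\<lambda>x. D x * D x) - integral {0..1} (\<lambda>x. D x * p (c x))"
      by (simp add: poly0 p)
    also have "\<dots> = integral {0..1} (\<lambda>x. D x * D x - D x * p (c x))"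
      by (intro integral_diff[symmetric] integrable_continuous_real contDD cpc pc)
    also have "\<dots> \<le> integral {0..1} (\<lambda>x. e * \<bar>D x\<bar>)"
    proof (intro integral_le integrable_continuous_real)
      show "continuous_on {0..1} (\<lambda>x. D x * D x - D x * p (c x))"
        by (intro continuous_on_diff contDD cpc pc)
      show "continuous_on {0..1} (\<lambda>x. e * \<bar>D x\<bar>)"
        by (intro continuous_intros cont)
      fix t :: real assume t: "t \<in> {0..1}"
      have "D t * D t - D t * p (c t) = D t * (E (c t) - p (c t))"
        by (simp add: DE[OF t] algebra_simps)
      also have "\<dots> \<le> \<bar>D t\<bar> * \<bar>E (c t) - p (c t)\<bar>"
        by (metis abs_ge_self abs_mult)
      also have "\<dots> \<le> \<bar>D t\<bar> * e"
        using p(2)[of "c t"] by (intro mult_left_mono) (auto simp: c_def)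
      finally show "D t * D t - D t * p (c t) \<le> e * \<bar>D t\<bar>"
        by (simp add: mult.commute)
    qed
    finally show ?thesis by (simp add: A_def)
  qed
  \<comment> \<open>If the integral \<open>I\<close> of \<open>D * D\<close> were positive,
    \<open>e = 1\<close> would give \<open>A > 0\<close>, and then \<open>e = I / (2 * A)\<close>
    would give \<open>I \<le> I / 2\<close>.\<close>
  have "integral {0..1} (\<lambda>x. D x * D x) \<le> 0"
  proof (rule ccontr)
    assume "\<not> ?thesis"
    then have I: "integral {0..1} (\<lambda>x. D x * D x) > 0" by simp
    with eA[of 1] have "A > 0" by simp
    with I eA[of "integral {0..1} (\<lambda>x. D x * D x) / (2 * A)"] show False by simp
  qed
  moreover have "integral {0..1} (\<lambda>x. D x * D x) \<ge> 0"
    by (intro integral_nonneg integrable_continuous_real contDD) auto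
  ultimately have "integral {0..1} (\<lambda>x. D x * D x) = 0" by simp
  then show ?thesis
    using integral_eq_0_iff[OF contDD] x by auto
qed

section \<open>Numerical estimates for the factorial and the theta series\<close>

text \<open>From \<open>m\<close> to \<open>m + 1\<close> the left side grows by the factor
  \<open>(m + 1) * (1 + 1 / m) ^ m / exp 1\<close>, which is at most the factor \<open>m + 1\<close>
  of the factorial.\<close>

lemma exp_mult_power_le_fact:
  assumes "m > 0"
  shows "exp (1 - real m) * real m ^ m \<le> fact m"
  using assms
proof (induction m rule: nat_induct_non_zero)
  case 1
  then show ?case by simp
next
  case (Suc m)
  have "(1 + 1 / real m) ^ m \<le> exp 1"
    using Suc.hyps by (intro exp_ge_one_plus_x_over_n_power_n) auto
  then have "(1 + 1 / real m) ^ m * real m ^ m \<le> exp 1 * real m ^ m"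
    by (intro mult_right_mono) auto
  moreover have "(1 + 1 / real m) ^ m * real m ^ m = real (Suc m) ^ m"
    using Suc.hyps by (simp add: field_simps flip: power_mult_distrib)
  ultimately have "exp (- real m) * (real (Suc m) ^ m * real (Suc m)) \<le>
      exp (- real m) * (exp 1 * real m ^ m * real (Suc m))"
    by (intro mult_left_mono mult_right_mono) auto
  also have "\<dots> = real (Suc m) * (exp (1 - real m) * real m ^ m)"
    by (simp add: exp_diff exp_minus field_simps)
  also have "\<dots> \<le> real (Suc m) * fact m"
    by (intro mult_left_mono Suc.IH) auto
  finally show ?case
    by (simp add: algebra_simps)
qed

lemma exp_le_hfun:
  assumes "m > 0"
  shows "exp ((1 - real m) / 2) \<le> hfun m"
  unfolding hfun_def
proof (rule real_le_rsqrt)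
  show "(exp ((1 - real m) / 2))\<^sup>2 \<le> fact m / real m ^ m"
    using exp_mult_power_le_fact[OF assms] assms
    by (subst exp_double[symmetric]) (simp add: pos_le_divide_eq diff_divide_distrib)
qed

text \<open>Beyond the leading term \<open>q\<close>, the powers with square exponents are dominated
  by a geometric series of ratio \<open>q ^ 5\<close> starting at \<open>q ^ 4\<close>. The total is
  \<open>q * (1 + q ^ 3 / (1 - q ^ 5))\<close>.\<close>

lemma theta_tail_bound:
  fixes q :: real
  assumes q: "0 \<le> q" "q \<le> 59 / 100"
  shows "(\<lambda>n. q ^ (Suc n)\<^sup>2) summable_on UNIV"
    and "\<bar>\<Sum>\<^sub>\<infinity>n. q ^ (Suc n)\<^sup>2 * cos (c n)\<bar> \<le> 1.222 * q"
proof -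
  \<comment> \<open>The bounds 0.0715 and 0.2054 are the fifth and third powers of 0.59, rounded
    up.\<close>
  have q5: "q ^ 5 \<le> 0.0715"
    using power_mono[OF q(2,1), of 5] by (simp add: power_divide)
  have q3: "q ^ 3 \<le> 0.2054"
    using power_mono[OF q(2,1), of 3] by (simp add: power_divide)
  define b where "b n = (case n of 0 \<Rightarrow> q | Suc k \<Rightarrow> q ^ 4 * (q ^ 5) ^ k)" for n
  have "(\<lambda>k. b (Suc k)) sums (q ^ 4 * (1 / (1 - q ^ 5)))"
    unfolding b_def nat.case using q q5 by (intro sums_mult[OF geometric_sums]) simp
  then have bs: "b sums (q ^ 4 * (1 / (1 - q ^ 5)) + q)"
    by (subst (asm) sums_Suc_iff) (simp add: b_def)
  have b0: "b n \<ge> 0" for n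
    using q by (simp add: b_def split: nat.split)
  have le: "q ^ (Suc n)\<^sup>2 \<le> b n" for n
  proof (cases n)
    case (Suc k)
    \<comment> \<open>Here the base is \<open>k + 2\<close>, and
      \<open>(k + 2)^2 = k^2 + 4 * k + 4\<close> with \<open>k^2 \<ge> k\<close>.\<close>
    have "4 + 5 * k \<le> (Suc n)\<^sup>2"
      using Suc le_square[of k] by (simp add: power2_eq_square)
    then have "q ^ (Suc n)\<^sup>2 \<le> q ^ (4 + 5 * k)"
      using q by (intro power_decreasing) auto
    then show ?thesis
      by (simp add: b_def Suc power_add power_mult)
  qed (use q in \<open>simp add: b_def\<close>)
  have bsum: "b summable_on UNIV"
    using bs b0 by (intro norm_summable_imp_summable_on) (simp add: sums_iff)
  show qsum: "(\<lambda>n. q ^ (Suc n)\<^sup>2) summable_on UNIV"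
    by (rule summable_on_comparison_test[OF bsum]) (use le q in auto)
  have "infsum b UNIV = q ^ 4 * (1 / (1 - q ^ 5)) + q"
    using has_sum_imp_sums[OF has_sum_infsum[OF bsum]] bs by (rule sums_unique2)
  also have "\<dots> = q * (q ^ 3 / (1 - q ^ 5) + 1)"
    by (simp add: algebra_simps power_numeral_reduce)
  also have "\<dots> \<le> q * (0.2054 / (1 - 0.0715) + 1)"
    using q q3 q5 by (intro mult_left_mono add_mono frac_le) auto
  also have "\<dots> \<le> 1.222 * q"
    using q by simp
  finally have B: "infsum b UNIV \<le> 1.222 * q" .
  have cb: "\<bar>q ^ (Suc n)\<^sup>2 * cos (c n)\<bar> \<le> b n" for n
  proof -
    have "q ^ (Suc n)\<^sup>2 * \<bar>cos (c n)\<bar> \<le> q ^ (Suc n)\<^sup>2 * 1"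
      using q by (intro mult_left_mono) auto
    then show ?thesis using le[of n] q by (simp add: abs_mult)
  qed
  have "norm (\<Sum>\<^sub>\<infinity>n. q ^ (Suc n)\<^sup>2 * cos (c n)) \<le> infsum b UNIV"
  proof (rule norm_infsum_le[OF has_sum_infsum has_sum_infsum[OF bsum]])
    show "(\<lambda>n. q ^ (Suc n)\<^sup>2 * cos (c n)) summable_on UNIV"
      by (rule abs_summable_summable, rule Infinite_Sum.abs_summable_on_comparison_test'[OF bsum]) (use cb in auto)
  qed (use cb in auto)
  with B show "\<bar>\<Sum>\<^sub>\<infinity>n. q ^ (Suc n)\<^sup>2 * cos (c n)\<bar> \<le> 1.222 * q"
    by simp
qed

text \<open>With \<open>m\<close> the floor of \<open>36 * \<sigma>^2\<close>, the exponent of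
  \<open>q\<close> exceeds \<open>18 * \<sigma>^2 \<ge> m / 2\<close>, so
  \<open>q < exp (- m / 2)\<close>. The lower bound \<open>exp ((1 - m) / 2)\<close> for
  \<open>hfun m\<close> has an extra factor \<open>exp (1 / 2)\<close>, and 1.5 times this factor,
  about 2.47, beats \<open>2 * 1.222 = 2.444\<close>.\<close>

lemma exp_bound_le_hfun:
  fixes \<sigma> :: real
  assumes "\<sigma> \<ge> 1 / 6"
  defines "q \<equiv> exp (- 2 * pi\<^sup>2 * \<sigma>\<^sup>2)"
  shows "q \<le> 59 / 100" and "2 * (1.222 * q) \<le> 1.5 * hfun (nat \<lfloor>36 * \<sigma>\<^sup>2\<rfloor>)"
proof -
  have s: "\<sigma>\<^sup>2 \<ge> 1 / 36"
    using power_mono[OF assms(1), of 2] by (simp add: power2_eq_square)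
  have "pi\<^sup>2 \<ge> 3.14\<^sup>2"
    using pi_approx by (intro power_mono) auto
  then have "2 * pi\<^sup>2 * \<sigma>\<^sup>2 \<ge> 19.7 * \<sigma>\<^sup>2"
    by (intro mult_right_mono) (auto simp: power2_eq_square)
  \<comment> \<open>With \<open>\<sigma>^2 \<ge> 1 / 36\<close>, the constants are
    \<open>(19.7 - 18) / 36\<close> and \<open>19.7 / 36\<close>, rounded down.\<close>
  then have le: "- 2 * pi\<^sup>2 * \<sigma>\<^sup>2 \<le> - 18 * \<sigma>\<^sup>2 - 0.047" "2 * pi\<^sup>2 * \<sigma>\<^sup>2 \<ge> 0.547"
    using s by auto
  have "1 / 0.59 \<le> (1 + 0.547 + 0.547\<^sup>2 / 2 :: real)"
    by (simp add: power2_eq_square)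
  also have "\<dots> \<le> exp 0.547"
    by (intro exp_lower_Taylor_quadratic) auto
  also have "\<dots> \<le> exp (2 * pi\<^sup>2 * \<sigma>\<^sup>2)"
    using le by simp
  finally show "q \<le> 59 / 100"
    by (simp add: q_def exp_minus field_simps)
  define m where "m = nat \<lfloor>36 * \<sigma>\<^sup>2\<rfloor>"
  have m: "m > 0" "real m \<le> 36 * \<sigma>\<^sup>2"
    using s by (auto simp: m_def of_nat_nat le_floor_iff)
  define E where "E = exp (- real m / 2)"
  have E: "0 < E" by (simp add: E_def)
  have "q \<le> E * exp (- 0.047)"
    using le m by (auto simp: q_def E_def simp flip: exp_add)
  also have "exp (- 0.047 :: real) \<le> 1 / (1 + 0.047)"
    using exp_ge_add_one_self[of "0.047::real"] by (simp add: exp_minus field_simps)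
  finally have "q \<le> E * (1000 / 1047)"
    using E by simp
  \<comment> \<open>\<open>1.625 = 1 + 1 / 2 + 1 / 8\<close> is the quadratic Taylor polynomial of
    \<open>exp\<close> at \<open>1 / 2\<close>; the factor \<open>1000 / 1047\<close> makes this
    lower bound sufficient.\<close>
  then have "2 * (1.222 * q) \<le> 1.5 * (1.625 * E)"
    using E by simp
  also have "\<dots> \<le> 1.5 * (exp (1 / 2) * E)"
    using exp_lower_Taylor_quadratic[of "1 / 2 :: real"]
    E by (intro mult_left_mono mult_right_mono) (auto simp: power2_eq_square)
  also have "exp (1 / 2) * E = exp ((1 - real m) / 2)"
    by (simp add: E_def diff_divide_distrib flip: exp_add)
  also have "1.5 * \<dots> \<le> 1.5 * hfun m"
    by (intro mult_left_mono exp_le_hfun m) auto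
  finally show "2 * (1.222 * q) \<le> 1.5 * hfun (nat \<lfloor>36 * \<sigma>\<^sup>2\<rfloor>)"
    by (simp add: m_def)
qed

section \<open>Convergence, symmetry and continuity of the wrapped density\<close>

lemma gauss_dens_minus: "gauss_dens 0 \<sigma> (- x) = gauss_dens 0 \<sigma> x"
  by (simp add: gauss_dens_eq)

lemma continuous_on_gauss_dens: "\<sigma> > 0 \<Longrightarrow> continuous_on S (gauss_dens \<mu> \<sigma>)"
  unfolding gauss_dens_eq by (intro continuous_intros) auto

text \<open>Two geometric series cover the integers; their overlap in 0 is harmless for
  summability.\<close>

lemma summable_on_power_nat_abs:
  fixes r :: real
  assumes "0 \<le> r" "r < 1"
  shows "(\<lambda>z::int. r ^ nat \<bar>z\<bar>) summable_on UNIV"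
proof -
  have r: "(\<lambda>n::nat. r ^ n) summable_on UNIV"
    using assms by (intro norm_summable_imp_summable_on) (simp add: norm_power)
  have "(\<lambda>z::int. r ^ nat \<bar>z\<bar>) summable_on range int"
    by (subst summable_on_reindex) (use r in \<open>auto simp: o_def\<close>)
  moreover have "(\<lambda>z::int. r ^ nat \<bar>z\<bar>) summable_on range (\<lambda>n. - int n)"
    by (subst summable_on_reindex) (use r in \<open>auto simp: o_def inj_on_def\<close>)
  moreover have "z \<in> range int \<union> range (\<lambda>n. - int n)" for z
    by (cases z rule: int_cases2) auto
  then have "range int \<union> range (\<lambda>n. - int n) = UNIV"
    by blast
  ultimately show ?thesis
    by (metis summable_on_union)
qed

text \<open>A majorant independent of \<open>x\<close> on bounded sets, as the M-test requires.
  Gaussian decay is weakened to geometric decay in \<open>\<bar>z\<bar>\<close>, which is easier to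
  sum.\<close>

lemma gauss_dens_shift_bound:
  assumes "\<sigma> > 0"
  obtains B :: "int \<Rightarrow> real" where "B summable_on UNIV"
    and "\<And>z x. \<bar>x\<bar> \<le> R \<Longrightarrow> \<bar>gauss_dens \<mu> \<sigma> (of_int z + x)\<bar> \<le> B z"
proof
  define r where "r = exp (- (1 / (2 * \<sigma>\<^sup>2)))"
  define C where "C = (2 * pi) powr (- 1 / 2) / \<sigma> * exp ((R + \<bar>\<mu>\<bar> + 1) / (2 * \<sigma>\<^sup>2))"
  show "(\<lambda>z. C * r ^ nat \<bar>z\<bar>) summable_on UNIV"
    using assms by (intro summable_on_cmult_right summable_on_power_nat_abs) (auto simp: r_def)
  fix z :: int and x :: real assume x: "\<bar>x\<bar> \<le> R"
  define t where "t = of_int z + x - \<mu>"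
  \<comment> \<open>Expanding the square gives \<open>t^2 \<ge> 2 * \<bar>t\<bar> - 1\<close>, hence
    \<open>t^2 \<ge> \<bar>t\<bar> - 1\<close>.\<close>
  have "0 \<le> (\<bar>t\<bar> - 1)\<^sup>2" "\<bar>t\<bar> \<ge> 0" by auto
  then have "\<bar>t\<bar> - 1 \<le> t\<^sup>2"
    unfolding power2_diff power2_abs by simp
  moreover have "\<bar>real_of_int z\<bar> \<le> \<bar>t\<bar> + R + \<bar>\<mu>\<bar>"
    using x by (simp add: t_def)
  ultimately have "- t\<^sup>2 \<le> (R + \<bar>\<mu>\<bar> + 1) - \<bar>real_of_int z\<bar>" by simp
  then have "- t\<^sup>2 / (2 * \<sigma>\<^sup>2) \<le> ((R + \<bar>\<mu>\<bar> + 1) - \<bar>real_of_int z\<bar>) / (2 * \<sigma>\<^sup>2)"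
    by (intro divide_right_mono) auto
  then have "exp (- ((t / \<sigma>)\<^sup>2 / 2)) \<le> exp (((R + \<bar>\<mu>\<bar> + 1) - \<bar>real_of_int z\<bar>) / (2 * \<sigma>\<^sup>2))"
    by (simp add: power_divide)
  also have "\<dots> = exp ((R + \<bar>\<mu>\<bar> + 1) / (2 * \<sigma>\<^sup>2)) * r ^ nat \<bar>z\<bar>"
  proof -
    have "r ^ nat \<bar>z\<bar> = exp (real (nat \<bar>z\<bar>) * (- (1 / (2 * \<sigma>\<^sup>2))))"
      unfolding r_def by (rule exp_of_nat_mult[symmetric])
    also have "\<dots> = exp (- (\<bar>real_of_int z\<bar> / (2 * \<sigma>\<^sup>2)))"
      by (simp add: of_nat_nat)
    finally show ?thesis
      by (simp add: diff_divide_distrib flip: exp_add)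
  qed
  finally have "(2 * pi) powr (- 1 / 2) / \<sigma> * exp (- ((t / \<sigma>)\<^sup>2 / 2)) \<le>
      (2 * pi) powr (- 1 / 2) / \<sigma> * (exp ((R + \<bar>\<mu>\<bar> + 1) / (2 * \<sigma>\<^sup>2)) * r ^ nat \<bar>z\<bar>)"
    using assms by (intro mult_left_mono) auto
  then show "\<bar>gauss_dens \<mu> \<sigma> (of_int z + x)\<bar> \<le> C * r ^ nat \<bar>z\<bar>"
    using assms by (simp add: gauss_dens_eq C_def t_def abs_mult mult.assoc)
qed

lemma wrapped_dens_add_int: "wrapped_dens \<mu> \<sigma> (x + of_int k) = wrapped_dens \<mu> \<sigma> x"
  unfolding wrapped_dens_def
  using infsum_reindex_bij_betw[of "\<lambda>z. z + k" UNIV UNIV "\<lambda>z. gauss_dens \<mu> \<sigma> (of_int z + x)"]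
  by (simp add: bij_plus_right add.commute add.left_commute)

lemma wrapped_dens_minus: "wrapped_dens 0 \<sigma> (- x) = wrapped_dens 0 \<sigma> x"
proof -
  have "gauss_dens 0 \<sigma> (of_int z - x) = gauss_dens 0 \<sigma> (of_int (- z) + x)" for z
    using gauss_dens_minus[of \<sigma> "of_int z - x"] by simp
  then show ?thesis
    unfolding wrapped_dens_def
    using infsum_reindex_bij_betw[OF bij_uminus, of "\<lambda>z. gauss_dens 0 \<sigma> (of_int z + x)"]
    by simp
qed

text \<open>Reduction to the centered case, where the density is even and its Fourier series
  contains cosines only.\<close>

lemma wrapped_dens_eq_wrapped_dens_0: "wrapped_dens \<mu> \<sigma> x = wrapped_dens 0 \<sigma> (x - \<mu>)"
  by (simp add: wrapped_dens_def gauss_dens_def algebra_simps)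

lemma borel_measurable_gauss_dens [measurable]: "gauss_dens \<mu> \<sigma> \<in> borel_measurable borel"
  unfolding gauss_dens_def by measurable

lemma integrable_gauss_dens:
  assumes "\<sigma> > 0"
  shows "integrable lborel (gauss_dens \<mu> \<sigma>)"
proof -
  have "gauss_dens \<mu> \<sigma> = normal_density \<mu> \<sigma>"
    using assms by (intro ext gauss_dens_eq_normal_density)
  then show ?thesis
    using assms by (simp add: integrable_normal_density)
qed

lemma continuous_on_wrapped_dens:
  assumes "\<sigma> > 0"
  shows "continuous_on {a..b} (wrapped_dens \<mu> \<sigma>)"
proof -
  obtain B where B: "B summable_on UNIV"
    "\<And>z x. \<bar>x\<bar> \<le> max \<bar>a\<bar> \<bar>b\<bar> \<Longrightarrow> \<bar>gauss_dens \<mu> \<sigma> (of_int z + x)\<bar> \<le> B z"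
    using gauss_dens_shift_bound[OF assms] by blast
  show ?thesis
    unfolding wrapped_dens_def[abs_def]
    by (rule has_sum_integral_infsum(1)[OF _ _ B(1)])
       (auto intro!: B(2) continuous_on_compose2[OF continuous_on_gauss_dens[OF assms, of UNIV]] continuous_intros)
qed

section \<open>Unwrapping integrals, Fourier coefficients and the cosine series\<close>

text \<open>Translating each piece to \<open>{x..y}\<close> leaves the periodic weight
  \<open>w\<close> unchanged, so the Gaussians add up to \<open>wrapped_dens\<close>. The weight 1
  serves the total mass and the c.d.f., a cosine the Fourier coefficients. Half-open pieces are
  disjoint even for \<open>x = 0\<close>, \<open>y = 1\<close>, where they tile the line.\<close>

lemma set_integral_gauss_dens_unwrap:
  fixes w :: "real \<Rightarrow> real"
  assumes \<sigma>: "\<sigma> > 0" and xy: "0 \<le> x" "x \<le> y" "y \<le> 1"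
    and w: "continuous_on UNIV w" "\<And>t. \<bar>w t\<bar> \<le> 1" "\<And>(z::int) t. w (of_int z + t) = w t"
  shows "(LINT t:(\<Union>z::int. {of_int z + x<..of_int z + y})|lborel. gauss_dens \<mu> \<sigma> t * w t) =
    integral {x..y} (\<lambda>t. wrapped_dens \<mu> \<sigma> t * w t)"
proof -
  define F where "F t = gauss_dens \<mu> \<sigma> t * w t" for t
  have [measurable]: "w \<in> borel_measurable borel"
    using w(1) by (rule borel_measurable_continuous_onI)
  have F: "integrable lborel F"
    unfolding F_def
  proof (rule Bochner_Integration.integrable_bound[OF integrable_gauss_dens[OF \<sigma>]])
    show "AE t in lborel. norm (gauss_dens \<mu> \<sigma> t * w t) \<le> norm (gauss_dens \<mu> \<sigma> t)"
      using w(2) by (auto simp: abs_mult intro!: mult_left_le)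
  qed simp
  have setF: "set_integrable lborel S F" if "S \<in> sets borel" for S
    unfolding set_integrable_def using F that by (intro integrable_mult_indicator) auto
  obtain B where B: "B summable_on UNIV"
    "\<And>z t. \<bar>t\<bar> \<le> 1 \<Longrightarrow> \<bar>gauss_dens \<mu> \<sigma> (of_int z + t)\<bar> \<le> B z"
    using gauss_dens_shift_bound[OF \<sigma>] by blast
  have Fz: "\<bar>F (of_int z + t)\<bar> \<le> B z" if "\<bar>t\<bar> \<le> 1" for z t
  proof -
    have "\<bar>F (of_int z + t)\<bar> \<le> \<bar>gauss_dens \<mu> \<sigma> (of_int z + t)\<bar>"
      using w(2) by (auto simp: F_def abs_mult intro!: mult_left_le)
    then show ?thesis using B(2)[OF that, of z] by simp
  qed
  have contF: "continuous_on S F" for S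
    unfolding F_def
    by (intro continuous_intros continuous_on_gauss_dens \<sigma> continuous_on_subset[OF w(1)]) auto
  define A where "A z = {real_of_int z + x<..real_of_int z + y}" for z
  have piece: "(LINT t:A z|lborel. F t) = integral {x..y} (\<lambda>t. F (of_int z + t))" for z
  proof -
    have "(LINT t:A z|lborel. F t) = integral {of_int z + x..of_int z + y} F"
      unfolding A_def using xy
      by (subst interval_integral_Ioc[symmetric]) (auto intro!: interval_integral_eq_integral setF)
    then show ?thesis
      using integral_shift_Icc_real[of x y F "of_int z"] by (simp add: o_def add.commute)
  qed
  have "((\<lambda>z. LINT t:A z|lborel. F t) has_sum integral {x..y} (\<lambda>t. \<Sum>\<^sub>\<infinity>z\<in>UNIV. F (of_int z + t))) UNIV"
    unfolding piece
    by (rule has_sum_integral_infsum(2)[OF _ _ B(1)])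
       (use xy in \<open>auto intro!: Fz continuous_on_compose2[OF contF[of UNIV]] continuous_intros\<close>)
  also have "(\<lambda>t. \<Sum>\<^sub>\<infinity>z\<in>UNIV. F (of_int z + t)) = (\<lambda>t. wrapped_dens \<mu> \<sigma> t * w t)"
    by (simp add: F_def w(3) wrapped_dens_def infsum_cmult_left')
  \<comment> \<open>Countable additivity of the integral is available for sequences of sets, so the
    integers are enumerated by \<open>int_decode\<close>; \<open>has_sum\<close> does not depend on
    the order.\<close>
  finally have "((\<lambda>n. LINT t:A (int_decode n)|lborel. F t) has_sum
      integral {x..y} (\<lambda>t. wrapped_dens \<mu> \<sigma> t * w t)) UNIV"
    by (subst has_sum_reindex_bij_betw[OF bij_int_decode])
  then have "(\<Sum>n. LINT t:A (int_decode n)|lborel. F t) =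
      integral {x..y} (\<lambda>t. wrapped_dens \<mu> \<sigma> t * w t)"
    by (intro sums_unique[symmetric] has_sum_imp_sums)
  moreover have "(LINT t:(\<Union>n. A (int_decode n))|lborel. F t) = (\<Sum>n. LINT t:A (int_decode n)|lborel. F t)"
  proof (rule lebesgue_integral_countable_add)
    show "A (int_decode i) \<inter> A (int_decode j) = {}" if "i \<noteq> j" for i j
    proof (rule ccontr)
      assume "A (int_decode i) \<inter> A (int_decode j) \<noteq> {}"
      then obtain t where t: "t \<in> A (int_decode i)" "t \<in> A (int_decode j)" by auto
      then have "real_of_int (int_decode i) < of_int (int_decode j) + 1"
        "real_of_int (int_decode j) < of_int (int_decode i) + 1"
        using xy by (auto simp: A_def)
      then have "int_decode i = int_decode j" by linarith
      then show False using that inj_int_decode by (auto dest: injD)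
    qed
    show "set_integrable lborel (\<Union>n. A (int_decode n)) F"
      by (rule setF) (auto simp: A_def)
  qed (auto simp: A_def)
  moreover have "(\<Union>n. A (int_decode n)) = (\<Union>z. A z)"
    using surj_int_decode by (metis image_image)
  ultimately show ?thesis
    by (simp add: A_def F_def)
qed

text \<open>The integral is the real part of the characteristic function of the standard normal
  distribution.\<close>

lemma integral_std_normal_density_cos:
  "(\<integral>x. std_normal_density x * cos (s * x) \<partial>lborel) = exp (- s\<^sup>2 / 2)"
proof -
  interpret real_distribution std_normal_distribution
    by (rule real_dist_normal_dist)
  have int: "complex_integrable std_normal_distribution (\<lambda>x. iexp (s * x))"
    by (rule integrable_iexp) auto
  have "exp (- s\<^sup>2 / 2) = Re (char std_normal_distribution s)"
    by (simp add: char_std_normal_distribution)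
  also have "\<dots> = (\<integral>x. cos (s * x) \<partial>std_normal_distribution)"
    unfolding char_def
    by (subst integral_Re[OF int, symmetric]) (simp add: Re_exp)
  also have "\<dots> = (\<integral>x. std_normal_density x * cos (s * x) \<partial>lborel)"
    by (subst integral_density) auto
  finally show ?thesis by simp
qed

lemma integral_gauss_dens_cos:
  assumes "\<sigma> > 0"
  shows "(\<integral>x. gauss_dens 0 \<sigma> x * cos (s * x) \<partial>lborel) = exp (- (s * \<sigma>)\<^sup>2 / 2)"
  using assms integral_std_normal_density_cos[of "s * \<sigma>"]
  by (subst lborel_integral_real_affine[where c = \<sigma> and t = 0])
     (auto simp: gauss_dens_def mult_ac power_mult_distrib)

lemma UN_Ioc_int: "(\<Union>z::int. {real_of_int z + 0<..of_int z + 1}) = UNIV"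
proof -
  have "t \<in> {real_of_int (\<lceil>t\<rceil> - 1) + 0<..of_int (\<lceil>t\<rceil> - 1) + 1}" for t :: real
    by simp linarith
  then show ?thesis by blast
qed

lemma integral_wrapped_dens:
  assumes "\<sigma> > 0"
  shows "integral {0..1} (wrapped_dens \<mu> \<sigma>) = 1"
proof -
  have "integral {0..1} (\<lambda>t. wrapped_dens \<mu> \<sigma> t * 1) =
      (LINT t:(\<Union>z::int. {of_int z + 0<..of_int z + 1})|lborel. gauss_dens \<mu> \<sigma> t * 1)"
    using assms by (intro set_integral_gauss_dens_unwrap[symmetric]) auto
  also have "\<dots> = 1"
    unfolding UN_Ioc_int using assms
    by (simp add: set_lebesgue_integral_def gauss_dens_eq_normal_density integral_normal_density)
  finally show ?thesis by simp
qed

text \<open>Unwrapping turns the coefficient into the Gaussian cosine integral at frequency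
  \<open>2 * pi * n\<close>, and \<open>(2 * pi * n * \<sigma>)^2 / 2 = n^2 * (2 * pi^2 *
  \<sigma>^2)\<close>.\<close>

lemma wrapped_dens_cosine_coefficient:
  fixes n :: nat
  assumes "\<sigma> > 0"
  shows "integral {0..1} (\<lambda>t. wrapped_dens 0 \<sigma> t * cos (2 * pi * n * t)) = exp (- 2 * pi\<^sup>2 * \<sigma>\<^sup>2) ^ n\<^sup>2"
proof -
  have per: "cos (2 * pi * n * (real_of_int z + t)) = cos (2 * pi * n * t)" for z t
  proof -
    have "2 * pi * n * (real_of_int z + t) = 2 * pi * n * t + 2 * pi * of_int (int n * z)"
      by (simp add: algebra_simps)
    then show ?thesis
      by (simp only: cos_add_2pi_int)
  qed
  have "integral {0..1} (\<lambda>t. wrapped_dens 0 \<sigma> t * cos (2 * pi * n * t)) =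
      (LINT t:(\<Union>z::int. {of_int z + 0<..of_int z + 1})|lborel. gauss_dens 0 \<sigma> t * cos (2 * pi * n * t))"
    by (rule set_integral_gauss_dens_unwrap[symmetric]) (use assms per in \<open>auto intro!: continuous_intros\<close>)
  also have "\<dots> = exp (- (2 * pi * n * \<sigma>)\<^sup>2 / 2)"
    unfolding UN_Ioc_int using integral_gauss_dens_cos[OF assms, of "2 * pi * n"]
    by (simp add: set_lebesgue_integral_def)
  also have "\<dots> = exp (real (n\<^sup>2) * (- 2 * pi\<^sup>2 * \<sigma>\<^sup>2))"
    by (simp add: power_mult_distrib)
  finally show ?thesis
    by (simp only: exp_of_nat_mult)
qed

text \<open>This is the transformation law of the theta function.\<close>

lemma wrapped_dens_eq_cosine_series:
  assumes \<sigma>: "\<sigma> > 0" and q: "q = exp (- 2 * pi\<^sup>2 * \<sigma>\<^sup>2)"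
    and summable: "(\<lambda>n. q ^ (Suc n)\<^sup>2) summable_on UNIV" and x: "x \<in> {0..1}"
  shows "wrapped_dens 0 \<sigma> x = 1 + 2 * (\<Sum>\<^sub>\<infinity>n. q ^ (Suc n)\<^sup>2 * cos (2 * pi * Suc n * x))"
proof -
  have q0: "q > 0" by (simp add: q)
  define f where "f n x = q ^ (Suc n)\<^sup>2 * cos (2 * pi * Suc n * x)" for n x
  define S where "S x = (\<Sum>\<^sub>\<infinity>n. f n x)" for x
  have contf: "continuous_on A (f n)" for A n
    unfolding f_def by (intro continuous_intros)
  have bf: "\<bar>f n x * cos c\<bar> \<le> q ^ (Suc n)\<^sup>2" for n x c
  proof -
    have "\<bar>cos (2 * pi * Suc n * x)\<bar> * \<bar>cos c\<bar> \<le> 1 * 1"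
      by (intro mult_mono) auto
    then show ?thesis
      using q0 by (simp add: f_def abs_mult mult.assoc mult_left_le)
  qed
  have contS: "continuous_on {0..1} S"
    unfolding S_def using bf[where c = 0]
    by (intro has_sum_integral_infsum(1)[OF contf _ summable]) auto
  \<comment> \<open>Orthogonality leaves only the term with \<open>Suc n = j\<close>, and the
    integral of the squared cosine gives the factor 1/2. The series starts at frequency 1, so the
    coefficient for \<open>j = 0\<close> vanishes.\<close>
  have coeffS: "integral {0..1} (\<lambda>x. S x * cos (2 * pi * real j * x)) =
      (if j = 0 then 0 else q ^ j\<^sup>2 / 2)" for j
  proof -
    have "((\<lambda>n. integral {0..1} (\<lambda>x. f n x * cos (2 * pi * real j * x))) has_sum
        integral {0..1} (\<lambda>x. \<Sum>\<^sub>\<infinity>n. f n x * cos (2 * pi * real j * x))) UNIV"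
      by (intro has_sum_integral_infsum(2)[OF _ _ summable] bf continuous_intros contf)
    also have "(\<lambda>n. integral {0..1} (\<lambda>x. f n x * cos (2 * pi * real j * x))) =
        (\<lambda>n. if Suc n = j then q ^ j\<^sup>2 / 2 else 0)"
    proof
      fix n
      show "integral {0..1} (\<lambda>x. f n x * cos (2 * pi * real j * x)) = (if Suc n = j then q ^ j\<^sup>2 / 2 else 0)"
        unfolding f_def mult.assoc[of "q ^ _"] integral_mult_right
        by (subst integral_cos_2pi_times_cos_2pi) auto
    qed
    also have "(\<lambda>x. \<Sum>\<^sub>\<infinity>n. f n x * cos (2 * pi * real j * x)) = (\<lambda>x. S x * cos (2 * pi * real j * x))"
      by (simp add: S_def infsum_cmult_left')
    finally have hs: "((\<lambda>n. if Suc n = j then q ^ j\<^sup>2 / 2 else 0) has_sum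
        integral {0..1} (\<lambda>x. S x * cos (2 * pi * real j * x))) UNIV" .
    moreover have "((\<lambda>n. if Suc n = j then q ^ j\<^sup>2 / 2 else 0) has_sum
        (if j = 0 then 0 else q ^ j\<^sup>2 / 2)) UNIV"
      \<comment> \<open>For \<open>j = 0\<close> the truncated \<open>j - 1\<close> is 0, where the
        summand vanishes as well.\<close>
      by (rule has_sum_finite_neutralI[of "{j - 1}"]) (cases j; auto split: if_splits)+
    ultimately show ?thesis
      by (rule has_sum_unique)
  qed
  define D where "D x = wrapped_dens 0 \<sigma> x - (1 + 2 * S x)" for x
  have "D x = 0"
  proof (rule cosine_coefficients_zero_imp_zero[OF _ _ _ x])
    show "continuous_on {0..1} D"
      unfolding D_def by (intro continuous_intros continuous_on_wrapped_dens \<sigma> contS)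
    show "D (1 - x) = D x" for x
    proof -
      have "cos (2 * pi * Suc n * (1 - x)) = cos (2 * pi * Suc n * x)" for n
      proof -
        have "2 * pi * Suc n * (1 - x) = - (2 * pi * Suc n * x) + 2 * pi * of_int (int (Suc n))"
          by (simp add: algebra_simps)
        then show ?thesis
          by (simp only: cos_add_2pi_int cos_minus)
      qed
      then have "S (1 - x) = S x"
        by (simp only: S_def f_def)
      moreover have "wrapped_dens 0 \<sigma> (1 - x) = wrapped_dens 0 \<sigma> x"
        using wrapped_dens_add_int[of 0 \<sigma> "- x" 1] wrapped_dens_minus[of \<sigma> x] by simp
      ultimately show ?thesis by (simp add: D_def)
    qed
    fix n :: nat
    have "integral {0..1} (\<lambda>x. D x * cos (2 * pi * real n * x)) =
        integral {0..1} (\<lambda>x. wrapped_dens 0 \<sigma> x * cos (2 * pi * real n * x) -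
          (cos (2 * pi * real n * x) + 2 * (S x * cos (2 * pi * real n * x))))"
      by (simp add: D_def algebra_simps)
    also have "\<dots> = integral {0..1} (\<lambda>x. wrapped_dens 0 \<sigma> x * cos (2 * pi * real n * x)) -
          (integral {0..1} (\<lambda>x. cos (2 * pi * real n * x)) +
            integral {0..1} (\<lambda>x. 2 * (S x * cos (2 * pi * real n * x))))"
      by (subst integral_diff, (intro integrable_continuous_real continuous_intros
            continuous_on_wrapped_dens \<sigma> contS)+, subst integral_add,
          (intro integrable_continuous_real continuous_intros contS)+) simp
    also have "integral {0..1} (\<lambda>x. cos (2 * pi * real n * x)) = (if n = 0 then 1 else 0)"
      using integral_unique[OF has_integral_cos_2pi[of "int n"]] by simp
    \<comment> \<open>For \<open>n > 0\<close> the coefficients give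
      \<open>q ^ n^2 - (0 + 2 * (q ^ n^2 / 2))\<close>, for \<open>n = 0\<close> they give
      \<open>1 - (1 + 0)\<close>.\<close>
    finally show "integral {0..1} (\<lambda>x. D x * cos (2 * pi * real n * x)) = 0"
      using wrapped_dens_cosine_coefficient[OF \<sigma>, of n]
      by (simp add: coeffS q)
  qed
  then show ?thesis
    by (simp add: D_def S_def f_def)
qed

section \<open>Uniform deviation of the density and increments of the c.d.f\<close>

lemma wrapped_dens_minus_one_bound:
  assumes "\<sigma> \<ge> 1 / 6"
  shows "\<bar>wrapped_dens \<mu> \<sigma> x - 1\<bar> \<le> 1.5 * hfun (nat \<lfloor>36 * \<sigma>\<^sup>2\<rfloor>)"
proof -
  define q where "q = exp (- 2 * pi\<^sup>2 * \<sigma>\<^sup>2)"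
  have q: "0 \<le> q" "q \<le> 59 / 100" "2 * (1.222 * q) \<le> 1.5 * hfun (nat \<lfloor>36 * \<sigma>\<^sup>2\<rfloor>)"
    using exp_bound_le_hfun[OF assms] by (auto simp: q_def)
  \<comment> \<open>Centering and periodicity move the argument into [0, 1], where the cosine series
    is established.\<close>
  define t where "t = frac (x - \<mu>)"
  have t: "t \<in> {0..1}"
    using frac_lt_1[of "x - \<mu>"] by (simp add: t_def frac_ge_0)
  have "wrapped_dens \<mu> \<sigma> x = wrapped_dens 0 \<sigma> t"
    unfolding wrapped_dens_eq_wrapped_dens_0[of \<mu>] t_def
    using wrapped_dens_add_int[of 0 \<sigma> "frac (x - \<mu>)" "\<lfloor>x - \<mu>\<rfloor>"] by (simp add: frac_def)
  also have "\<dots> = 1 + 2 * (\<Sum>\<^sub>\<infinity>n. q ^ (Suc n)\<^sup>2 * cos (2 * pi * Suc n * t))"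
    using assms theta_tail_bound(1)[OF q(1,2)] t
    by (intro wrapped_dens_eq_cosine_series) (auto simp: q_def)
  finally show ?thesis
    using theta_tail_bound(2)[OF q(1,2), of "\<lambda>n. 2 * pi * Suc n * t"] q(3) by simp
qed

text \<open>The event that the fractional part lies in \<open>{x<..y}\<close> is, up to a null set,
  that \<open>Y\<close> lies in an integer translate of this interval; unwrapping with weight 1 then
  applies.\<close>

lemma frac_cdf_diff_eq_integral:
  assumes "prob_space M" and \<sigma>: "\<sigma> > 0"
    and dist: "distributed M lborel Y (\<lambda>x. ennreal (gauss_dens \<mu> \<sigma> x))"
    and xy: "0 \<le> x" "x < y" "y \<le> 1"
  shows "prob_space.frac_cdf M Y y - prob_space.frac_cdf M Y x = integral {x..y} (wrapped_dens \<mu> \<sigma>)"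
proof -
  interpret prob_space M by fact
  have Y [measurable]: "Y \<in> borel_measurable M"
    using distributed_measurable[OF dist] by simp
  define U where "U = (\<Union>z::int. {real_of_int z + x<..of_int z + y})"
  have [measurable]: "U \<in> sets borel"
    by (auto simp: U_def)
  have "{t::real. x < frac t \<and> frac t \<le> y} \<in> sets borel"
    unfolding frac_def by measurable
  note this[measurable]
  have "frac_cdf Y y - frac_cdf Y x = prob {\<omega> \<in> space M. x < frac (Y \<omega>) \<and> frac (Y \<omega>) \<le> y}"
    unfolding frac_cdf_def using xy
    by (subst finite_measure_Diff[symmetric]) (auto simp: frac_def intro!: arg_cong[where f = prob])
  also have "\<dots> = (\<integral>\<omega>. indicator {t. x < frac t \<and> frac t \<le> y} (Y \<omega>) \<partial>M)"
  proof -
    have "prob {\<omega> \<in> space M. x < frac (Y \<omega>) \<and> frac (Y \<omega>) \<le> y} =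
        (\<integral>\<omega>. indicator {\<omega> \<in> space M. x < frac (Y \<omega>) \<and> frac (Y \<omega>) \<le> y} \<omega> \<partial>M)"
      by (simp add: Collect_conj_eq Int_ac)
    also have "\<dots> = (\<integral>\<omega>. indicator {t. x < frac t \<and> frac t \<le> y} (Y \<omega>) \<partial>M)"
      by (intro Bochner_Integration.integral_cong) (auto simp: indicator_def)
    finally show ?thesis .
  qed
  also have "\<dots> = (\<integral>t. gauss_dens \<mu> \<sigma> t * indicator {t. x < frac t \<and> frac t \<le> y} t \<partial>lborel)"
    using \<sigma> by (intro distributed_integral[OF dist, symmetric]) (auto simp: gauss_dens_def)
  also have "\<dots> = (\<integral>t. gauss_dens \<mu> \<sigma> t * indicator U t \<partial>lborel)"
  proof (rule integral_cong_AE)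
    \<comment> \<open>For \<open>y = 1\<close> the two sets differ: \<open>U\<close> contains the
      integers, whose fractional part 0 is not above \<open>x\<close>. Hence the integers are
      removed as a null set.\<close>
    have "AE t in lborel. t \<notin> (\<int> :: real set)"
      by (intro AE_not_in countable_imp_null_set_lborel countable_int)
    then show "AE t in lborel. gauss_dens \<mu> \<sigma> t * indicator {t. x < frac t \<and> frac t \<le> y} t =
        gauss_dens \<mu> \<sigma> t * indicator U t"
    proof eventually_elim
      case (elim t)
      have "x < frac t \<and> frac t \<le> y \<longleftrightarrow> t \<in> U"
      proof
        assume "x < frac t \<and> frac t \<le> y"
        then show "t \<in> U"
          unfolding U_def by (intro UN_I[of "\<lfloor>t\<rfloor>"]) (auto simp: frac_def)
      next
        assume "t \<in> U"
        then obtain z :: int where z: "of_int z + x < t" "t \<le> of_int z + y"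
          by (auto simp: U_def)
        have "t \<noteq> of_int (z + 1)"
          using elim by (metis Ints_of_int)
        then have "\<lfloor>t\<rfloor> = z"
          using z xy by (intro floor_unique) auto
        then show "x < frac t \<and> frac t \<le> y"
          using z by (simp add: frac_def)
      qed
      then show ?case by (simp add: indicator_def)
    qed
  qed measurable
  also have "\<dots> = (LINT t:U|lborel. gauss_dens \<mu> \<sigma> t * 1)"
    by (simp add: set_lebesgue_integral_def mult.commute)
  also have "\<dots> = integral {x..y} (\<lambda>t. wrapped_dens \<mu> \<sigma> t * 1)"
    unfolding U_def using \<sigma> xy by (intro set_integral_gauss_dens_unwrap) auto
  finally show ?thesis by simp
qed

section \<open>The three bounds\<close>

theorem theorem6:
  fixes M :: "'a measure" and Y :: "'a \<Rightarrow> real" and \<mu> \<sigma> :: real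
  assumes "prob_space M"
    and "\<sigma> \<ge> 1 / 6"
    and "distributed M lborel Y (\<lambda>x. ennreal (gauss_dens \<mu> \<sigma> x))"
  shows "osc (wrapped_dens \<mu> \<sigma>) \<le> ereal (4.5 * hfun (nat \<lfloor>36 * \<sigma>\<^sup>2\<rfloor>))
    \<and> kuiper_dist (prob_space.frac_cdf M Y) \<le> ereal (0.75 * hfun (nat \<lfloor>36 * \<sigma>\<^sup>2\<rfloor>))
    \<and> mrae (prob_space.frac_cdf M Y) \<le> ereal (3 * hfun (nat \<lfloor>36 * \<sigma>\<^sup>2\<rfloor>))"
proof -
  define h where "h = hfun (nat \<lfloor>36 * \<sigma>\<^sup>2\<rfloor>)"
  define g where "g = wrapped_dens \<mu> \<sigma>"
  define G where "G = prob_space.frac_cdf M Y"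
  have h0: "h \<ge> 0"
    by (simp add: h_def hfun_def)
  have \<sigma>: "\<sigma> > 0" using assms(2) by linarith
  have gb: "\<bar>g x - 1\<bar> \<le> 1.5 * h" for x
    unfolding g_def h_def by (rule wrapped_dens_minus_one_bound[OF assms(2)])
  have int_le: "\<bar>integral {a..b} g - (b - a)\<bar> \<le> 1.5 * h * (b - a)" if "a \<le> b" for a b
  proof -
    have c: "continuous_on {a..b} g"
      unfolding g_def by (rule continuous_on_wrapped_dens[OF \<sigma>])
    have "integral {a..b} g - (b - a) = integral {a..b} (\<lambda>t. g t - 1)"
      using that by (subst integral_diff) (auto intro!: integrable_continuous_real c)
    then show ?thesis
      using integral_bound[OF that continuous_on_diff[OF c continuous_on_const[of _ 1]], of "1.5 * h"] gb by simp
  qed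
  have Gd: "G y - G x = integral {x..y} g" if "0 \<le> x" "x < y" "y \<le> 1" for x y
    unfolding G_def g_def using frac_cdf_diff_eq_integral[OF assms(1) \<sigma> assms(3)] that by blast
  have diff1: "\<bar>G y - G x - (y - x)\<bar> \<le> 1.5 * h * (y - x)" if "0 \<le> x" "x < y" "y \<le> 1" for x y
    using int_le[of x y] Gd[OF that] that by simp
  have diff2: "\<bar>G y - G x - (y - x)\<bar> \<le> 1.5 * h * (1 - (y - x))" if "0 \<le> x" "x < y" "y \<le> 1" for x y
  proof -
    have i: "g integrable_on {a..b}" for a b
      unfolding g_def by (intro integrable_continuous_real continuous_on_wrapped_dens \<sigma>)
    have "integral {0..x} g + integral {x..y} g = integral {0..y} g"
      "integral {0..y} g + integral {y..1} g = integral {0..1} g"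
      using that by (auto intro!: Henstock_Kurzweil_Integration.integral_combine i)
    moreover have "integral {0..1} g = 1"
      unfolding g_def by (rule integral_wrapped_dens[OF \<sigma>])
    ultimately have "G y - G x - (y - x) = - (integral {0..x} g - (x - 0)) - (integral {y..1} g - (1 - y))"
      using Gd[OF that] by simp
    then have "\<bar>G y - G x - (y - x)\<bar> \<le> 1.5 * h * (x - 0) + 1.5 * h * (1 - y)"
      using int_le[of 0 x] int_le[of y 1] that by linarith
    then show ?thesis by (simp add: field_simps)
  qed
  \<comment> \<open>In the average of the two bounds the length \<open>y - x\<close> cancels,
    leaving \<open>1.5 * h / 2\<close>.\<close>
  have "\<bar>G y - G x - (y - x)\<bar> \<le> 0.75 * h" if "0 \<le> x" "x < y" "y \<le> 1" for x y
    using diff1[OF that] diff2[OF that] by (simp add: algebra_simps)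
  then have kuiper: "kuiper_dist G \<le> ereal (0.75 * h)"
    unfolding kuiper_dist_def by (intro SUP_least) auto
  have "\<bar>(G y - G x) / (y - x) - 1\<bar> \<le> 3 * h" if "0 \<le> x" "x < y" "y \<le> 1" for x y
  proof -
    have "(G y - G x) / (y - x) - 1 = (G y - G x - (y - x)) / (y - x)"
      using that by (simp add: field_simps)
    then have "\<bar>(G y - G x) / (y - x) - 1\<bar> = \<bar>G y - G x - (y - x)\<bar> / (y - x)"
      using that by simp
    also have "\<dots> \<le> 1.5 * h"
      using diff1[OF that] that by (simp add: divide_le_eq)
    also have "\<dots> \<le> 3 * h"
      using h0 by simp
    finally show ?thesis .
  qed
  then have mrae: "mrae G \<le> ereal (3 * h)"
    unfolding mrae_def by (intro SUP_least) auto
  \<comment> \<open>The triangle inequality through the value 1 gives \<open>3 * h\<close>, which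
    \<open>h0\<close> relaxes to \<open>4.5 * h\<close>.\<close>
  have "\<bar>g y - g x\<bar> \<le> 4.5 * h" for x y
    using gb[of x] gb[of y] h0 by linarith
  then have osc: "osc g \<le> ereal (4.5 * h)"
    unfolding osc_def by (intro SUP_least) auto
  from osc kuiper mrae show ?thesis
    by (simp add: g_def G_def h_def)
qed

end
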